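(* Let $M\in\mathrm{CM}(B_{k,n})$ be an indecomposable rank $2$ module with profile $I\mid J$, where $I$ and $J$ are $r$-interlacing $k$-subsets of $\{1,\dots,n\}$ with poset $1^{r_1}\mid 2$, where $r\ge r_1\ge 4$. Then there are infinitely many pairwise non-isomorphic rank $2$ indecomposable modules in $\mathrm{CM}(B_{k,n})$ with profile $I\mid J$.
   Context: Let $1\le k\le n/2$. Let $\Gamma_n$ be the quiver with vertices $1,\dots,n$ on a cycle (indices mod $n$, so vertex $0$ is vertex $n$) and arrows $x_i:i-1\to i$, $y_i:i\to i-1$. The algebra $B_{k,n}$ is the quotient of the completed path algebra of $\Gamma_n$ over $\mathbb C$ by the closure of the ideal generated by the relations $xy=yx$ and $x^k=y^{n-k}$ at every vertex (so $x$, $y$ stand for the appropriate $x_i$, $y_i$). Its centre is $Z=\mathbb C[[t]]$ with $t=\sum_i x_iy_i$. $\mathrm{CM}(B_{k,n})$ is the category of maximal Cohen-Macaulay $B_{k,n}$-modules, i.e. (finitely generated) modules free over $Z$. Such a module is a representation of $\Gamma_n$ by free $\mathbb C[[t]]$-modules $M_i$, all of the same finite rank, called the rank of $M$, satisfying the relations (so $x_iy_i=t\cdot\mathrm{id}$, $y_ix_i=t\cdot \mathrm{id}$, and any composite of $k$ consecutive $x$'s equals the composite of $n-k$ consecutive $y$'s with the same source and target). For a $k$-subset $I$ of $\{1,\dots,n\}$, $L_I$ is the rank $1$ module with $\mathbb C[[t]]$ at every vertex, where $x_i$ is multiplication by $1$ if $i\in I$ and by $t$ if $i\notin I$, and $y_i$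 is multiplication by $t$ if $i\in I$ and by $1$ if $i\notin I$. A rank $2$ module $M$ has profile (filtration) $I\mid J$ if it has a submodule isomorphic to $L_J$ with quotient isomorphic to $L_I$. $I$ and $J$ are $r$-interlacing if there exist subsets $\{i_1,i_3,\dots,i_{2r-1}\}\subset I\setminus J$ and $\{i_2,i_4,\dots,i_{2r}\}\subset J\setminus I$ such that $i_1<i_2<i_3<\dots<i_{2r}<i_1$ cyclically, and there exist no larger subsets of $I$ and of $J$ with this property. Poset: the rim of $I$ is the path through the vertices $0,1,\dots,n$ which goes half a step down from $i-1$ to $i$ if $i\in I$ and half a step up if $i\notin I$. Place the rim of $J$ below that of $I$, as far up as possible so that no part of it is strictly above the rim of $I$. Equivalently, let $d:\mathbb Z/n\to\mathbb Z_{\ge 0}$ be the function with minimum $0$ such that $d(i)-d(i-1)=1$ if $i\in J\setminus I$, $-1$ if $i\in I\setminus J$, and $0$ otherwise. The boxes of $I\mid J$ are the bounded regions enclosed between the two rims, i.e. they correspond to the maximal cyclic intervals of vertices on which $d>0$. If there are $r_1$ boxes, one says that the poset of $I\mid J$ is $1^{r_1}\mid 2$. *)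

theory Defs
  imports "HOL-Algebra.Algebra" "HOL-Algebra.Algebraic_Closure_Type"
    "HOL-Computational_Algebra.Formal_Power_Series"
begin

section \<open>Modules over the centre\<close>

(* C[[t]], with t = fps_X. *)
abbreviation centre :: "complex fps ring"
  where "centre \<equiv> ring_of_type_algebra"

definition mod_hom :: "(complex fps, 'a) module \<Rightarrow> (complex fps, 'b) module \<Rightarrow> ('a \<Rightarrow> 'b) set"
  where "mod_hom V W =
    {f \<in> hom (add_monoid V) (add_monoid W).
       \<forall>a \<in> carrier centre. \<forall>v \<in> carrier V. f (a \<odot>\<^bsub>V\<^esub> v) = a \<odot>\<^bsub>W\<^esub> f v}"

definition free_of_rank :: "(complex fps, 'a) module \<Rightarrow> nat \<Rightarrow> bool"
  where "free_of_rank V m \<longleftrightarrow>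
    (\<exists>B. finite B \<and> card B = m \<and> B \<subseteq> carrier V \<and>
      (\<forall>v \<in> carrier V. \<exists>!c. c \<in> B \<rightarrow>\<^sub>E carrier centre \<and> v = (\<Oplus>\<^bsub>V\<^esub>b\<in>B. c b \<odot>\<^bsub>V\<^esub> b)))"

(* The fields mult and one, which the record module inherits from ring, play no role. *)
definition quot_module :: "(complex fps, 'a) module \<Rightarrow> 'a set \<Rightarrow> (complex fps, 'a set) module"
  where "quot_module V N =
    \<lparr>carrier = a_rcosets\<^bsub>V\<^esub> N,
     monoid.mult = (\<lambda>_ _. undefined), one = undefined,
     ring.zero = N, ring.add = set_add V,
     module.smult = (\<lambda>a C. \<Union>c\<in>C. N +>\<^bsub>V\<^esub> (a \<odot>\<^bsub>V\<^esub> c))\<rparr>"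


section \<open>Representations of the cyclic quiver\<close>

(* The representative in {1..n} of an integer modulo n; vertex 0 is vertex n. *)
definition vert :: "nat \<Rightarrow> int \<Rightarrow> nat"
  where "vert n j = nat ((j - 1) mod int n) + 1"

(* Only the values at the vertices 1..n (resp. at the arrows with these indices) are relevant.
   The arrow x_i goes from i - 1 to i, and y_i from i to i - 1. *)
record 'a qrep =
  space :: "nat \<Rightarrow> (complex fps, 'a) module"
  xmap :: "nat \<Rightarrow> 'a \<Rightarrow> 'a"
  ymap :: "nat \<Rightarrow> 'a \<Rightarrow> 'a"

(* Composite of m consecutive x's (resp. y's) with source i:
   x_{i+m} ... x_{i+1} and y_{i-m+1} ... y_i. *)
primrec xpath :: "nat \<Rightarrow> 'a qrep \<Rightarrow> nat \<Rightarrow> nat \<Rightarrow> 'a \<Rightarrow> 'a"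
  where
    "xpath n M i 0 v = v"
  | "xpath n M i (Suc m) v = xmap M (vert n (int i + int m + 1)) (xpath n M i m v)"

primrec ypath :: "nat \<Rightarrow> 'a qrep \<Rightarrow> nat \<Rightarrow> nat \<Rightarrow> 'a \<Rightarrow> 'a"
  where
    "ypath n M i 0 v = v"
  | "ypath n M i (Suc m) v = ymap M (vert n (int i - int m)) (ypath n M i m v)"

(* Modules over B_{k,n}, as representations satisfying the relations; the action of the central
   element t = sum of the x_i y_i is part of the C[[t]]-module structure of the spaces. *)
definition B_module :: "nat \<Rightarrow> nat \<Rightarrow> 'a qrep \<Rightarrow> bool"
  where "B_module k n M \<longleftrightarrow>
    (\<forall>i \<in> {1..n}. let h = vert n (int i - 1) in
      Module.module centre (space M i) \<and>
      xmap M i \<in> mod_hom (space M h) (space M i) \<and>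
      ymap M i \<in> mod_hom (space M i) (space M h) \<and>
      (\<forall>v \<in> carrier (space M i). xmap M i (ymap M i v) = fps_X \<odot>\<^bsub>space M i\<^esub> v) \<and>
      (\<forall>v \<in> carrier (space M h). ymap M i (xmap M i v) = fps_X \<odot>\<^bsub>space M h\<^esub> v) \<and>
      (\<forall>v \<in> carrier (space M i). xpath n M i k v = ypath n M i (n - k) v))"

definition has_rank :: "nat \<Rightarrow> 'a qrep \<Rightarrow> nat \<Rightarrow> bool"
  where "has_rank n M m \<longleftrightarrow> (\<forall>i \<in> {1..n}. free_of_rank (space M i) m)"

definition CM_module :: "nat \<Rightarrow> nat \<Rightarrow> 'a qrep \<Rightarrow> bool"
  where "CM_module k n M \<longleftrightarrow> B_module k n M \<and> (\<exists>m. has_rank n M m)"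

definition qrep_iso :: "nat \<Rightarrow> 'a qrep \<Rightarrow> 'b qrep \<Rightarrow> bool"
  where "qrep_iso n M N \<longleftrightarrow>
    (\<exists>f. \<forall>i \<in> {1..n}. let h = vert n (int i - 1) in
      f i \<in> mod_hom (space M i) (space N i) \<and>
      bij_betw (f i) (carrier (space M i)) (carrier (space N i)) \<and>
      (\<forall>v \<in> carrier (space M h). f i (xmap M i v) = xmap N i (f h v)) \<and>
      (\<forall>v \<in> carrier (space M i). f h (ymap M i v) = ymap N i (f i v)))"

definition subrep :: "nat \<Rightarrow> 'a qrep \<Rightarrow> (nat \<Rightarrow> 'a set) \<Rightarrow> bool"
  where "subrep n M N \<longleftrightarrow>
    (\<forall>i \<in> {1..n}. let h = vert n (int i - 1) in
      submodule (N i) centre (space M i) \<and>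
      xmap M i ` N h \<subseteq> N i \<and> ymap M i ` N i \<subseteq> N h)"

definition restrict_rep :: "'a qrep \<Rightarrow> (nat \<Rightarrow> 'a set) \<Rightarrow> 'a qrep"
  where "restrict_rep M N = M\<lparr>space := (\<lambda>i. (space M i)\<lparr>carrier := N i\<rparr>)\<rparr>"

definition quot_rep :: "nat \<Rightarrow> 'a qrep \<Rightarrow> (nat \<Rightarrow> 'a set) \<Rightarrow> 'a set qrep"
  where "quot_rep n M N =
    \<lparr>space = (\<lambda>i. quot_module (space M i) (N i)),
     xmap = (\<lambda>i C. \<Union>c\<in>C. N i +>\<^bsub>space M i\<^esub> xmap M i c),
     ymap = (\<lambda>i C. let h = vert n (int i - 1) in \<Union>c\<in>C. N h +>\<^bsub>space M h\<^esub> ymap M i c)\<rparr>"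

definition zero_family :: "nat \<Rightarrow> 'a qrep \<Rightarrow> (nat \<Rightarrow> 'a set) \<Rightarrow> bool"
  where "zero_family n M N \<longleftrightarrow> (\<forall>i \<in> {1..n}. N i = {\<zero>\<^bsub>space M i\<^esub>})"

definition indecomposable :: "nat \<Rightarrow> 'a qrep \<Rightarrow> bool"
  where "indecomposable n M \<longleftrightarrow>
    \<not> zero_family n M (\<lambda>i. carrier (space M i)) \<and>
    (\<forall>N N'. subrep n M N \<and> subrep n M N' \<and>
      (\<forall>i \<in> {1..n}. N i \<inter> N' i = {\<zero>\<^bsub>space M i\<^esub>} \<and>
                   N i <+>\<^bsub>space M i\<^esub> N' i = carrier (space M i))
      \<longrightarrow> zero_family n M N \<or> zero_family n M N')"

definition L_rep :: "nat set \<Rightarrow> complex fps qrep"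
  where "L_rep I =
    \<lparr>space = (\<lambda>_. \<lparr>carrier = UNIV, monoid.mult = (*), one = 1, ring.zero = 0, ring.add = (+),
                   module.smult = (*)\<rparr>),
     xmap = (\<lambda>i v. if i \<in> I then v else fps_X * v),
     ymap = (\<lambda>i v. if i \<in> I then fps_X * v else v)\<rparr>"

definition has_profile :: "nat \<Rightarrow> 'a qrep \<Rightarrow> nat set \<Rightarrow> nat set \<Rightarrow> bool"
  where "has_profile n M I J \<longleftrightarrow>
    (\<exists>N. subrep n M N \<and> qrep_iso n (restrict_rep M N) (L_rep J) \<and>
         qrep_iso n (quot_rep n M N) (L_rep I))"


section \<open>Combinatorics of pairs of subsets\<close>

(* c 0 < c 1 < ... < c (m - 1) < c 0 cyclically: some rotation of the sequence increases. *)
definition cyclically_increasing :: "nat \<Rightarrow> (nat \<Rightarrow> nat) \<Rightarrow> bool"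
  where "cyclically_increasing m c \<longleftrightarrow> (\<exists>s. strict_mono_on {..<m} (\<lambda>j. c ((j + s) mod m)))"

definition alternates :: "nat set \<Rightarrow> nat set \<Rightarrow> nat \<Rightarrow> bool"
  where "alternates I J r \<longleftrightarrow>
    (\<exists>c. (\<forall>j<r. c (2 * j) \<in> I - J \<and> c (2 * j + 1) \<in> J - I) \<and>
         cyclically_increasing (2 * r) c)"

definition interlacing :: "nat \<Rightarrow> nat set \<Rightarrow> nat set \<Rightarrow> bool"
  where "interlacing r I J \<longleftrightarrow> alternates I J r \<and> (\<forall>r'>r. \<not> alternates I J r')"

(* d i is the gap at vertex i between the rim of I and the rim of J, the latter being placed
   below the former and touching it. *)
definition rim_gap :: "nat \<Rightarrow> nat set \<Rightarrow> nat set \<Rightarrow> (nat \<Rightarrow> int) \<Rightarrow> bool"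
  where "rim_gap n I J d \<longleftrightarrow>
    (\<forall>i \<in> {1..n}. d i - d (vert n (int i - 1)) =
       (if i \<in> J - I then 1 else if i \<in> I - J then -1 else 0)) \<and>
    Min (d ` {1..n}) = 0"

definition cyclic_interval :: "nat \<Rightarrow> nat set \<Rightarrow> bool"
  where "cyclic_interval n A \<longleftrightarrow>
    (\<exists>a l. 0 < l \<and> A = (\<lambda>j. vert n (a + int j)) ` {..<l})"

definition boxes :: "nat \<Rightarrow> (nat \<Rightarrow> int) \<Rightarrow> nat set set"
  where "boxes n d =
    {A. cyclic_interval n A \<and> (\<forall>i \<in> A. 0 < d i) \<and>
        (\<forall>A'. cyclic_interval n A' \<and> (\<forall>i \<in> A'. 0 < d i) \<and> A \<subseteq> A' \<longrightarrow> A' = A)}"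

(* The poset of I | J is 1^{r1} | 2. *)
definition has_poset :: "nat \<Rightarrow> nat set \<Rightarrow> nat set \<Rightarrow> nat \<Rightarrow> bool"
  where "has_poset n I J r1 \<longleftrightarrow> (\<exists>d. rim_gap n I J d \<and> card (boxes n d) = r1)"

end

theory Submission
  imports Defs "HOL-Library.Product_Plus"
begin

text \<open>
  A module with profile I | J is a cyclic chain of lattices between L_J and L_I inside a fixed plane
  with basis e, f over the Laurent series in t; where the gap d is positive, such a lattice may be
  spanned by t^d e and f + c e, with a scalar c that is constant on each box. The chain thus puts a
  line of C^2 on every box, while at a vertex with gap 0 the lattice is the standard one. A
  homomorphism is determined by its matrix at such a vertex, and modulo t this matrix maps the line
  of each box to the corresponding line. With the slopes 0, 1, -1 on three boxes it is scalar modulo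
  t. Hence idempotents are trivial, and the slope on a fourth box is an isomorphism invariant.
\<close>

section \<open>Vertices of the cycle\<close>

lemma vert_in: "0 < n \<Longrightarrow> vert n j \<in> {1..n}"
proof -
  assume "0 < n"
  then have "0 \<le> (j - 1) mod int n" "(j - 1) mod int n < int n" by auto
  then show ?thesis by (auto simp: vert_def)
qed

lemma vert_of_nat: "i \<in> {1..n} \<Longrightarrow> vert n (int i) = i"
  by (auto simp: vert_def)

lemma int_vert: "0 < n \<Longrightarrow> int (vert n j) = (j - 1) mod int n + 1"
  by (simp add: vert_def)

lemma vert_eq_iff: "0 < n \<Longrightarrow> vert n i = vert n j \<longleftrightarrow> (i - 1) mod int n = (j - 1) mod int n"
  by (metis int_vert add_right_cancel of_nat_eq_iff)

lemma vert_vert_add: "0 < n \<Longrightarrow> vert n (int (vert n j) + m) = vert n (j + m)"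
  by (simp add: vert_eq_iff int_vert) (simp add: mod_simps algebra_simps)

lemma vert_vert_diff: "0 < n \<Longrightarrow> vert n (int (vert n j) - m) = vert n (j - m)"
  using vert_vert_add[of n j "- m"] by simp

lemma vert_add_period: "0 < n \<Longrightarrow> vert n (j + int n) = vert n j"
  by (simp add: vert_eq_iff) (metis add_diff_eq add.commute diff_add_eq mod_add_self2)

lemma vert_pred: "i \<in> {1..n} \<Longrightarrow> vert n (int i - 1) \<in> {1..n}"
  using vert_in[of n] by auto

lemma vert_period_bij: "0 < n \<Longrightarrow> bij_betw (\<lambda>m. vert n (a + int m)) {..<n} {1..n}"
proof -
  assume n: "0 < n"
  have "inj_on (\<lambda>m. vert n (a + int m)) {..<n}"
  proof (rule inj_onI)
    fix x y assume xy: "x \<in> {..<n}" "y \<in> {..<n}" "vert n (a + int x) = vert n (a + int y)"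
    then have "int n dvd (a + int x - 1) - (a + int y - 1)"
      using n by (simp add: vert_eq_iff mod_eq_dvd_iff)
    then have "int n dvd int x - int y" by simp
    then show "x = y"
      using xy(1,2) by (metis mod_eq_dvd_iff lessThan_iff mod_less of_nat_eq_iff zmod_int)
  qed
  moreover have "(\<lambda>m. vert n (a + int m)) ` {..<n} \<subseteq> {1..n}"
    using n vert_in by blast
  ultimately show ?thesis
    by (simp add: bij_betw_def card_image card_subset_eq)
qed

text \<open>Induction along the cycle: any vertex \<open>z\<close> may serve as the base case, since
  a full period of forward steps from \<open>z\<close> reaches every vertex.\<close>

lemma vertex_induct:
  assumes z: "z \<in> {1..n}" "P z" and i: "i \<in> {1..n}"
    and step: "\<And>i. i \<in> {1..n} \<Longrightarrow> P (vert n (int i - 1)) \<Longrightarrow> P i"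
  shows "P i"
proof -
  have n: "0 < n" using i by auto
  have P: "P (vert n (int z + int m))" for m
  proof (induction m)
    case 0 then show ?case using z by (simp add: vert_of_nat)
  next
    case (Suc m)
    show ?case
      by (rule step) (use Suc n vert_in in \<open>auto simp: vert_vert_diff simp del: atLeastAtMost_iff\<close>)
  qed
  from vert_period_bij[OF n, of "int z"] i obtain m where "i = vert n (int z + int m)"
    by (auto simp: bij_betw_def simp del: atLeastAtMost_iff)
  then show ?thesis using P by simp
qed


section \<open>The free module of rank two\<close>

definition plane :: "(complex fps, complex fps \<times> complex fps) module"
  where "plane = \<lparr>carrier = UNIV, monoid.mult = (\<lambda>_ _. undefined), one = undefined,
    ring.zero = 0, ring.add = (+), module.smult = (\<lambda>a v. (a * fst v, a * snd v))\<rparr>"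

lemma plane_simps [simp]:
  "carrier plane = UNIV" "\<zero>\<^bsub>plane\<^esub> = 0" "v \<oplus>\<^bsub>plane\<^esub> w = v + w"
  "a \<odot>\<^bsub>plane\<^esub> v = (a * fst v, a * snd v)"
  by (simp_all add: plane_def)

lemma centre_simps [simp]:
  "carrier centre = UNIV" "\<zero>\<^bsub>centre\<^esub> = 0" "\<one>\<^bsub>centre\<^esub> = 1" "a \<oplus>\<^bsub>centre\<^esub> b = a + b"
  "a \<otimes>\<^bsub>centre\<^esub> b = a * b"
  by (simp_all add: ring_of_type_algebra_def)

lemma abelian_group_plane: "abelian_group plane"
proof (rule abelian_groupI)
  fix x :: "complex fps \<times> complex fps"
  show "\<exists>y\<in>carrier plane. y \<oplus>\<^bsub>plane\<^esub> x = \<zero>\<^bsub>plane\<^esub>"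
    by (rule bexI[of _ "- x"]) auto
qed (auto simp: add_ac)

lemma module_plane: "Module.module centre plane"
  by (rule moduleI) (auto simp: abelian_group_plane cring_from_type_algebra algebra_simps)

lemma plane_a_inv: "\<ominus>\<^bsub>plane\<^esub> v = - v"
  using abelian_group.minus_equality[OF abelian_group_plane, of "- v" v] by simp

lemma free_of_rank_plane: "free_of_rank plane 2"
  unfolding free_of_rank_def
proof (intro exI[of _ "{(1, 0), (0, 1)}"] conjI ballI)
  fix v :: "complex fps \<times> complex fps"
  interpret abelian_group plane by (rule abelian_group_plane)
  have sum: "(\<Oplus>\<^bsub>plane\<^esub>b\<in>{(1, 0), (0, 1)}. c b \<odot>\<^bsub>plane\<^esub> b) = (c (1, 0), c (0, 1))" for c
    by (subst finsum_insert) (auto simp: zero_prod_def)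
  show "\<exists>!c. c \<in> {(1, 0), (0, 1)} \<rightarrow>\<^sub>E carrier centre \<and>
      v = (\<Oplus>\<^bsub>plane\<^esub>b\<in>{(1, 0), (0, 1)}. c b \<odot>\<^bsub>plane\<^esub> b)"
  \<comment> \<open>A coefficient function has to be \<open>undefined\<close> off the basis, hence
    the restricted lambda.\<close>
  proof (rule ex1I[of _ "\<lambda>b\<in>{(1, 0), (0, 1)}. if b = (1, 0) then fst v else snd v"], unfold sum)
    fix c assume "c \<in> {(1, 0), (0, 1)} \<rightarrow>\<^sub>E carrier centre \<and> v = (c (1, 0), c (0, 1))"
    then show "c = (\<lambda>b\<in>{(1, 0), (0, 1)}. if b = (1, 0) then fst v else snd v)"
      by (intro extensionalityI[of _ "{(1, 0), (0, 1)}"]) (auto simp: PiE_def)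
  qed auto
qed auto

lemma mod_hom_plane_iff:
  "f \<in> mod_hom plane plane \<longleftrightarrow>
    (\<forall>v w. f (v + w) = f v + f w) \<and> (\<forall>a v. f (a * fst v, a * snd v) = (a * fst (f v), a * snd (f v)))"
  by (auto simp: mod_hom_def hom_def)

lemma mod_hom_plane_matrix:
  assumes "f \<in> mod_hom plane plane"
  shows "f (p, q) = (p * fst (f (1, 0)) + q * fst (f (0, 1)), p * snd (f (1, 0)) + q * snd (f (0, 1)))"
proof -
  have add: "f (v + w) = f v + f w" and scale: "f (a * fst v, a * snd v) = (a * fst (f v), a * snd (f v))"
    for a v w
    using assms unfolding mod_hom_plane_iff by blast+
  have "f (p, q) = f (p, 0) + f (0, q)"
    using add[of "(p, 0)" "(0, q)"] by simp
  then show ?thesis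
    using scale[of p "(1, 0)"] scale[of q "(0, 1)"] by simp
qed

section \<open>Gluing along the boxes\<close>

text \<open>The chain of lattices in coordinates: at vertex i the basis is t^(d i) e and f + lam i
  e. In these bases every arrow is upper triangular, with the diagonal of L_J and L_I, and the
  change of slope is the off-diagonal entry.\<close>

definition glue_rep :: "nat \<Rightarrow> nat set \<Rightarrow> nat set \<Rightarrow> (nat \<Rightarrow> complex) \<Rightarrow> (complex fps \<times> complex fps) qrep"
  where "glue_rep n I J lam =
    \<lparr>space = (\<lambda>_. plane),
     xmap = (\<lambda>i v. ((if i \<in> J then fst v else fps_X * fst v)
         + fps_const (lam (vert n (int i - 1)) - lam i) * snd v,
       if i \<in> I then snd v else fps_X * snd v)),
     ymap = (\<lambda>i v. ((if i \<in> J then fps_X * fst v else fst v)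
         - fps_const (lam (vert n (int i - 1)) - lam i) * snd v,
       if i \<in> I then fps_X * snd v else snd v))\<rparr>"

lemma space_glue_rep [simp]: "space (glue_rep n I J lam) i = plane"
  by (simp add: glue_rep_def)

text \<open>The common computation for both arrows. In the application x and y are the powers of t
  at the target and the source of the arrow, a and b are its diagonal entries, and l, m are the
  slopes at the vertices i - 1 and i.\<close>

lemma shear_identities:
  fixes x y a b l m p q :: "'b :: comm_ring_1"
  assumes "x * a = b * y" "x * (l - m) = b * (l - m)"
  shows "x * (a * p + (l - m) * q) + m * (b * q) = b * (y * p + l * q)"
    and "x * (a * p - (l - m) * q) + l * (b * q) = b * (y * p + m * q)"
proof -
  have "x * (a * p + (l - m) * q) = b * y * p + b * (l - m) * q"
    by (simp only: distrib_left mult.assoc[symmetric] assms)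
  then show "x * (a * p + (l - m) * q) + m * (b * q) = b * (y * p + l * q)"
    by (simp add: algebra_simps)
  have "x * (a * p - (l - m) * q) = x * a * p - x * (l - m) * q"
    by (simp add: algebra_simps)
  also have "\<dots> = b * y * p - b * (l - m) * q"
    by (simp only: assms)
  finally show "x * (a * p - (l - m) * q) + l * (b * q) = b * (y * p + m * q)"
    by (simp add: algebra_simps)
qed

text \<open>The gap takes values in the natural numbers so that it can be an exponent of t; the two
  indicators in \<open>gap_step\<close> are placed on opposite sides to avoid truncated
  subtraction.\<close>

locale rim_pair =
  fixes n k :: nat and I J :: "nat set" and d :: "nat \<Rightarrow> nat"
  assumes n_pos: "0 < n" and k_le: "k \<le> n"
    and I_subset: "I \<subseteq> {1..n}" and card_I: "card I = k"
    and gap_step: "\<And>i. i \<in> {1..n} \<Longrightarrow>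
      d i + (if i \<in> I - J then 1 else 0) = d (vert n (int i - 1)) + (if i \<in> J - I then 1 else 0)"
begin

definition constant_on_boxes :: "(nat \<Rightarrow> complex) \<Rightarrow> bool"
  where "constant_on_boxes lam \<longleftrightarrow>
    (\<forall>i \<in> {1..n}. let h = vert n (int i - 1) in
      (d i = 0 \<longrightarrow> lam i = 0) \<and> (0 < d i \<and> 0 < d h \<longrightarrow> lam i = lam h))"

(* The vector with coordinates v in the basis t^(d i) e, f + lam i e of the lattice at vertex i. *)
definition embed :: "(nat \<Rightarrow> complex) \<Rightarrow> nat \<Rightarrow> complex fps \<times> complex fps \<Rightarrow> complex fps \<times> complex fps"
  where "embed lam i v = (fps_X ^ d i * fst v + fps_const (lam i) * snd v, snd v)"

text \<open>The scalar by which \<open>y_i\<close> acts in L_A; \<open>x_i\<close> acts in L_A by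
  the scalar of the complement of A.\<close>

definition weight :: "nat set \<Rightarrow> nat \<Rightarrow> complex fps"
  where "weight A i = (if i \<in> A then fps_X else 1)"

lemma weight_nonzero [simp]: "weight A i \<noteq> 0"
  by (simp add: weight_def)

lemma inj_embed: "inj (embed lam i)"
  by (auto simp: inj_def embed_def prod_eq_iff)

text \<open>The gap changes by at most one along an arrow, so the slope can change only where the
  arrow enters or leaves a box, and there the gaps are exactly 0 and 1.\<close>

lemma jump_cases:
  assumes "constant_on_boxes lam" "i \<in> {1..n}"
  obtains "lam (vert n (int i - 1)) = lam i"
  | "i \<in> J - I" "d (vert n (int i - 1)) = 0" "d i = 1" "lam (vert n (int i - 1)) = 0"
  | "i \<in> I - J" "d (vert n (int i - 1)) = 1" "d i = 0" "lam i = 0"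
proof -
  have h: "vert n (int i - 1) \<in> {1..n}" using vert_pred assms(2) by blast
  have "d i = 0 \<Longrightarrow> lam i = 0" "d (vert n (int i - 1)) = 0 \<Longrightarrow> lam (vert n (int i - 1)) = 0"
    "0 < d i \<Longrightarrow> 0 < d (vert n (int i - 1)) \<Longrightarrow> lam i = lam (vert n (int i - 1))"
    using assms h unfolding constant_on_boxes_def Let_def by blast+
  then show thesis
    using gap_step[OF assms(2)] that by (cases "d i = 0"; cases "d (vert n (int i - 1)) = 0") (auto split: if_splits)
qed

text \<open>\<open>gap_step\<close> in multiplicative form, which makes the diagonal entries of the
  arrows compatible with the embeddings.\<close>

lemma gap_power:
  fixes x :: "'b :: comm_monoid_mult"
  assumes "i \<in> {1..n}"
  shows "x ^ d i * (if i \<in> J then 1 else x) = (if i \<in> I then 1 else x) * x ^ d (vert n (int i - 1))"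
    and "x ^ d (vert n (int i - 1)) * (if i \<in> J then x else 1) = (if i \<in> I then x else 1) * x ^ d i"
  using gap_step[OF assms] by (auto simp: mult.commute simp flip: power_Suc split: if_splits)

text \<open>At a jump the power of t at the target of the arrow equals the scalar by which the arrow
  acts in the ambient plane. The off-diagonal entry is therefore a constant, with no
  denominator.\<close>

lemma jump_power:
  fixes x :: "'b :: comm_monoid_mult"
  assumes "constant_on_boxes lam" "i \<in> {1..n}" "lam (vert n (int i - 1)) \<noteq> lam i"
  shows "x ^ d i = (if i \<in> I then 1 else x)" and "x ^ d (vert n (int i - 1)) = (if i \<in> I then x else 1)"
  using jump_cases[OF assms(1,2)] assms(3) by (cases; simp)+

text \<open>In the ambient plane the arrow is a mere scalar that depends on I alone; J and the
  slopes enter only through the embeddings. Relations between paths thus become identities of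
  scalars.\<close>

lemma embed_xmap:
  assumes "constant_on_boxes lam" "i \<in> {1..n}"
  shows "embed lam i (xmap (glue_rep n I J lam) i v) =
    weight (- I) i \<odot>\<^bsub>plane\<^esub> embed lam (vert n (int i - 1)) v"
proof -
  define h where "h = vert n (int i - 1)"
  define a b :: "complex fps" where "a = (if i \<in> J then 1 else fps_X)" and "b = (if i \<in> I then 1 else fps_X)"
  define c where "c = fps_const (lam h) - fps_const (lam i)"
  have X: "fps_X ^ d i * a = b * fps_X ^ d h"
    unfolding a_def b_def h_def by (rule gap_power(1)[OF assms(2)])
  have "fps_X ^ d i * c = b * c"
    using jump_power(1)[OF assms, of "fps_X :: complex fps"]
    by (cases "lam h = lam i") (simp_all add: c_def h_def b_def)
  then have "fps_X ^ d i * (a * fst v + c * snd v) + fps_const (lam i) * (b * snd v) =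
      b * (fps_X ^ d h * fst v + fps_const (lam h) * snd v)"
    using shear_identities(1)[OF X] unfolding c_def by blast
  then show ?thesis
    by (auto simp: embed_def glue_rep_def weight_def a_def b_def c_def h_def)
qed

lemma embed_ymap:
  assumes "constant_on_boxes lam" "i \<in> {1..n}"
  shows "embed lam (vert n (int i - 1)) (ymap (glue_rep n I J lam) i v) =
    weight I i \<odot>\<^bsub>plane\<^esub> embed lam i v"
proof -
  define h where "h = vert n (int i - 1)"
  define a b :: "complex fps" where "a = (if i \<in> J then fps_X else 1)" and "b = (if i \<in> I then fps_X else 1)"
  define c where "c = fps_const (lam h) - fps_const (lam i)"
  have X: "fps_X ^ d h * a = b * fps_X ^ d i"
    unfolding a_def b_def h_def by (rule gap_power(2)[OF assms(2)])
  have "fps_X ^ d h * c = b * c"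
    using jump_power(2)[OF assms, of "fps_X :: complex fps"]
    by (cases "lam h = lam i") (simp_all add: c_def h_def b_def)
  then have "fps_X ^ d h * (a * fst v - c * snd v) + fps_const (lam h) * (b * snd v) =
      b * (fps_X ^ d i * fst v + fps_const (lam i) * snd v)"
    using shear_identities(2)[OF X] unfolding c_def by blast
  then show ?thesis
    by (auto simp: embed_def glue_rep_def weight_def a_def b_def c_def h_def)
qed

section \<open>The relation x^k = y^(n-k)\<close>

lemma embed_xpath:
  assumes "constant_on_boxes lam" "i \<in> {1..n}"
  shows "embed lam (vert n (int i + int m)) (xpath n (glue_rep n I J lam) i m v) =
    (\<Prod>j<m. weight (- I) (vert n (int i + 1 + int j))) \<odot>\<^bsub>plane\<^esub> embed lam i v"
proof (induction m)
  case 0 then show ?case using assms by (simp add: vert_of_nat)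
next
  case (Suc m)
  have "vert n (int (vert n (int i + int (Suc m))) - 1) = vert n (int i + int m)"
    using n_pos by (simp add: vert_vert_diff)
  then show ?case
    using embed_xmap[OF assms(1) vert_in[OF n_pos, of "int i + int (Suc m)"],
        of "xpath n (glue_rep n I J lam) i m v"] Suc
    by (simp add: algebra_simps)
qed

lemma embed_ypath:
  assumes "constant_on_boxes lam" "i \<in> {1..n}"
  shows "embed lam (vert n (int i - int m)) (ypath n (glue_rep n I J lam) i m v) =
    (\<Prod>j<m. weight I (vert n (int i - int j))) \<odot>\<^bsub>plane\<^esub> embed lam i v"
proof (induction m)
  case 0 then show ?case using assms by (simp add: vert_of_nat)
next
  case (Suc m)
  have "vert n (int (vert n (int i - int m)) - 1) = vert n (int i - int (Suc m))"
    using n_pos by (simp add: vert_vert_diff algebra_simps)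
  then show ?case
    using embed_ymap[OF assms(1) vert_in[OF n_pos, of "int i - int m"],
        of "ypath n (glue_rep n I J lam) i m v"] Suc
    by (simp add: algebra_simps)
qed

lemma prod_weight: "(\<Prod>j\<in>S. weight A (g j)) = fps_X ^ (\<Sum>j\<in>S. of_bool (g j \<in> A))"
  by (auto simp: power_sum weight_def intro!: prod.cong)

(* The windows {i+1..i+k} and {i-(n-k)+1..i} partition a period, which contains k elements of I. *)
lemma window_count:
  "(\<Sum>j<k. of_bool (vert n (int i + 1 + int j) \<in> - I)) =
    (\<Sum>j<n - k. of_bool (vert n (int i - int j) \<in> I) :: nat)"
proof -
  define g :: "nat \<Rightarrow> nat" where "g j = of_bool (vert n (int i + 1 + int j) \<in> I)" for j
  have "(\<Sum>j<n. g j) = (\<Sum>v\<in>{1..n}. of_bool (v \<in> I))"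
    unfolding g_def by (rule sum.reindex_bij_betw[OF vert_period_bij[OF n_pos]])
  also have "\<dots> = k"
    using I_subset card_I by (simp add: Int_absorb1 flip: sum.inter_restrict)
  finally have total: "(\<Sum>j<n. g j) = k" .
  have "(\<Sum>j<n. g j) = (\<Sum>j<k. g j) + (\<Sum>j\<in>{k..<n}. g j)"
    using k_le by (simp add: lessThan_atLeast0 sum.atLeastLessThan_concat)
  also have "(\<Sum>j\<in>{k..<n}. g j) = (\<Sum>j<n - k. of_bool (vert n (int i - int j) \<in> I))"
  \<comment> \<open>The positions i+1+j and i-(n-1-j) differ by n, so the last n-k vertices of the
    period are read backwards from i.\<close>
  proof (rule sum.reindex_bij_witness[of _ "\<lambda>j. n - 1 - j" "\<lambda>j. n - 1 - j"])
    fix j assume "j \<in> {k..<n}"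
    then have "int i + 1 + int j = int i - int (n - 1 - j) + int n" by (auto simp: of_nat_diff)
    then show "of_bool (vert n (int i - int (n - 1 - j)) \<in> I) = g j"
      using vert_add_period[OF n_pos] unfolding g_def by metis
  qed auto
  finally have "(\<Sum>j<k. g j) + (\<Sum>j<n - k. of_bool (vert n (int i - int j) \<in> I)) = k"
    using total by simp
  moreover have "(\<Sum>j<k. of_bool (vert n (int i + 1 + int j) \<in> - I)) + (\<Sum>j<k. g j) = k"
  proof -
    have "(\<Sum>j<k. of_bool (vert n (int i + 1 + int j) \<in> - I) + g j) = (\<Sum>j<k. 1)"
      by (intro sum.cong) (auto simp: g_def)
    then show ?thesis by (simp add: sum.distrib)
  qed
  ultimately show ?thesis by simp
qed

text \<open>Both paths end at the same vertex, and in the ambient plane both multiply by the same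
  power of t by \<open>window_count\<close>. Injectivity of the embedding at the endpoint
  concludes.\<close>

lemma xpath_eq_ypath:
  assumes "constant_on_boxes lam" "i \<in> {1..n}"
  shows "xpath n (glue_rep n I J lam) i k v = ypath n (glue_rep n I J lam) i (n - k) v"
proof -
  have "vert n (int i + int k) = vert n (int i - int (n - k))"
    using vert_add_period[OF n_pos, of "int i - int (n - k)"] k_le by (simp add: of_nat_diff)
  then have "embed lam (vert n (int i + int k)) (xpath n (glue_rep n I J lam) i k v) =
      embed lam (vert n (int i + int k)) (ypath n (glue_rep n I J lam) i (n - k) v)"
    using embed_xpath[OF assms, of k v] embed_ypath[OF assms, of "n - k" v]
    by (simp only: prod_weight window_count)
  then show ?thesis using inj_embed by (simp add: inj_eq)
qed

lemma B_module_glue_rep: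
  assumes "constant_on_boxes lam"
  shows "B_module k n (glue_rep n I J lam)"
  unfolding B_module_def Let_def
proof (intro ballI conjI)
  fix i assume i: "i \<in> {1..n}"
  fix v
  show "xpath n (glue_rep n I J lam) i k v = ypath n (glue_rep n I J lam) i (n - k) v"
    by (rule xpath_eq_ypath[OF assms i])
  show "xmap (glue_rep n I J lam) i (ymap (glue_rep n I J lam) i v) = fps_X \<odot>\<^bsub>space (glue_rep n I J lam) i\<^esub> v"
    using jump_cases[OF assms i] by cases (auto simp: glue_rep_def algebra_simps)
  show "ymap (glue_rep n I J lam) i (xmap (glue_rep n I J lam) i v) =
      fps_X \<odot>\<^bsub>space (glue_rep n I J lam) (vert n (int i - 1))\<^esub> v"
    using jump_cases[OF assms i] by cases (auto simp: glue_rep_def algebra_simps)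
qed (auto simp: module_plane mod_hom_plane_iff, auto simp: glue_rep_def algebra_simps)

lemma CM_module_glue_rep: "constant_on_boxes lam \<Longrightarrow> CM_module k n (glue_rep n I J lam)"
  and has_rank_glue_rep: "has_rank n (glue_rep n I J lam) 2"
  using B_module_glue_rep free_of_rank_plane by (auto simp: CM_module_def has_rank_def)

end

section \<open>The profile\<close>

lemma submodule_plane_iff:
  "submodule N centre plane \<longleftrightarrow>
    0 \<in> N \<and> (\<forall>v\<in>N. \<forall>w\<in>N. v + w \<in> N) \<and> (\<forall>a. \<forall>v\<in>N. (a * fst v, a * snd v) \<in> N)"
    (is "_ \<longleftrightarrow> ?R")
proof
  assume "submodule N centre plane"
  from module.submoduleE(2,4,5)[OF module_plane this] subgroup.one_closed[OF submodule.axioms(1)[OF this]]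
  show ?R by (auto simp: plane_def)
next
  assume R: ?R
  show "submodule N centre plane"
  proof (rule module.submoduleI[OF module_plane])
    fix v assume "v \<in> N"
    with R have "(- 1 * fst v, - 1 * snd v) \<in> N" by blast
    then show "\<ominus>\<^bsub>plane\<^esub> v \<in> N" by (simp add: plane_a_inv prod_eq_iff uminus_prod_def)
  qed (use R in auto)
qed

text \<open>The span of the first basis vector; taken at every vertex it is the submodule L_J, and
  the second coordinate identifies the quotient with L_I.\<close>

definition axis :: "(complex fps \<times> complex fps) set"
  where "axis = {v. snd v = 0}"

lemma coset_axis: "axis +>\<^bsub>plane\<^esub> v = {w. snd w = snd v}"
proof -
  have "w = (fst w - fst v, 0) + v" if "snd w = snd v" for w
    using that by (simp add: prod_eq_iff)
  then show ?thesis
    by (auto simp: a_r_coset_def' axis_def)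
qed

lemma a_rcosets_axis: "a_rcosets\<^bsub>plane\<^esub> axis = range (\<lambda>c. {w. snd w = c})"
  by (auto simp: A_RCOSETS_def' coset_axis)

lemma quot_plane_simps:
  "carrier (quot_module plane axis) = range (\<lambda>c. {w. snd w = c})"
  "{w. snd w = b} \<oplus>\<^bsub>quot_module plane axis\<^esub> {w. snd w = c} = {w. snd w = b + c}"
  "a \<odot>\<^bsub>quot_module plane axis\<^esub> {w. snd w = c} = {w. snd w = a * c}"
proof -
  show "carrier (quot_module plane axis) = range (\<lambda>c. {w. snd w = c})"
    by (simp add: quot_module_def a_rcosets_axis)
  show "{w. snd w = b} \<oplus>\<^bsub>quot_module plane axis\<^esub> {w. snd w = c} = {w. snd w = b + c}"
  proof -
    have "w = (fst w, b) + (0, c)" if "snd w = b + c" for w :: "complex fps \<times> complex fps"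
      using that by (simp add: prod_eq_iff)
    then show ?thesis
      by (auto simp: quot_module_def set_add_def') (metis add.right_neutral)
  qed
  show "a \<odot>\<^bsub>quot_module plane axis\<^esub> {w. snd w = c} = {w. snd w = a * c}"
    by (auto simp: quot_module_def coset_axis)
qed

lemma some_in_fibre: "snd (SOME w. snd w = c) = c"
  by (rule someI_ex) (meson snd_conv)

lemma glue_rep_profile:
  fixes n :: nat
  assumes "0 < n"
  shows "has_profile n (glue_rep n I J lam) I J"
  unfolding has_profile_def
proof (intro exI conjI)
  let ?M = "glue_rep n I J lam" and ?N = "\<lambda>_ :: nat. axis"
  show "subrep n ?M ?N"
    by (auto simp: subrep_def Let_def submodule_plane_iff) (auto simp: axis_def glue_rep_def)
  show "qrep_iso n (restrict_rep ?M ?N) (L_rep J)"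
    unfolding qrep_iso_def Let_def
  proof (intro exI[of _ "\<lambda>_. fst"] ballI conjI)
    show "bij_betw fst (carrier (space (restrict_rep ?M ?N) i)) (carrier (space (L_rep J) i))" for i
      by (rule bij_betwI[of _ _ _ "\<lambda>p. (p, 0)"]) (auto simp: restrict_rep_def L_rep_def axis_def)
  qed (auto simp: mod_hom_def hom_def restrict_rep_def L_rep_def axis_def glue_rep_def)
  show "qrep_iso n (quot_rep n ?M ?N) (L_rep I)"
    unfolding qrep_iso_def Let_def
  \<comment> \<open>A coset of the axis is a fibre of \<open>snd\<close>, so the second coordinate
    of the chosen representative does not depend on the choice.\<close>
  proof (intro exI[of _ "\<lambda>_ C. snd (SOME w. w \<in> C)"] ballI conjI)
    let ?f = "\<lambda>C :: (complex fps \<times> complex fps) set. snd (SOME w. w \<in> C)"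
    fix i
    show "?f \<in> mod_hom (space (quot_rep n ?M ?N) i) (space (L_rep I) i)"
      by (auto simp: mod_hom_def hom_def quot_rep_def L_rep_def quot_plane_simps some_in_fibre)
    show "bij_betw ?f (carrier (space (quot_rep n ?M ?N) i)) (carrier (space (L_rep I) i))"
      by (rule bij_betwI[of _ _ _ "\<lambda>c. {w. snd w = c}"])
        (auto simp: quot_rep_def L_rep_def quot_plane_simps some_in_fibre)
    show "?f (xmap (quot_rep n ?M ?N) i C) = xmap (L_rep I) i (?f C)"
      if C_in: "C \<in> carrier (space (quot_rep n ?M ?N) (vert n (int i - 1)))" for C
    proof -
      obtain c where C: "C = {w. snd w = c}"
        using C_in by (auto simp: quot_rep_def quot_plane_simps)
      have "xmap (quot_rep n ?M ?N) i C = {w. snd w = (if i \<in> I then c else fps_X * c)}"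
        by (auto simp: C quot_rep_def coset_axis glue_rep_def)
      then show ?thesis by (simp add: C L_rep_def some_in_fibre)
    qed
    show "?f (ymap (quot_rep n ?M ?N) i C) = ymap (L_rep I) i (?f C)"
      if C_in: "C \<in> carrier (space (quot_rep n ?M ?N) i)" for C
    proof -
      obtain c where C: "C = {w. snd w = c}"
        using C_in by (auto simp: quot_rep_def quot_plane_simps)
      have "ymap (quot_rep n ?M ?N) i C = {w. snd w = (if i \<in> I then fps_X * c else c)}"
        by (auto simp: C quot_rep_def coset_axis glue_rep_def)
      then show ?thesis by (simp add: C L_rep_def some_in_fibre)
    qed
  qed
qed


section \<open>Rigidity modulo t\<close>

text \<open>Only the y arrows are recorded: they already connect all vertices of the cycle.
  Isomorphisms and the projections of a decomposition both give such families.\<close>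

definition y_hom :: "nat \<Rightarrow> 'a qrep \<Rightarrow> 'b qrep \<Rightarrow> (nat \<Rightarrow> 'a \<Rightarrow> 'b) \<Rightarrow> bool"
  where "y_hom n M N f \<longleftrightarrow>
    (\<forall>i \<in> {1..n}. f i \<in> mod_hom (space M i) (space N i) \<and>
      (\<forall>v \<in> carrier (space M i). f (vert n (int i - 1)) (ymap M i v) = ymap N i (f i v)))"

lemma qrep_iso_refl: "qrep_iso n M M"
  unfolding qrep_iso_def by (rule exI[of _ "\<lambda>_ v. v"]) (auto simp: mod_hom_def hom_def Let_def bij_betw_def)

context rim_pair
begin

text \<open>In ambient coordinates the whole family is the single map \<open>f z\<close>. At z the
  embeddings are the identity, and passing from i - 1 to i amounts to cancelling the nonzero scalar
  of \<open>y_i\<close>.\<close>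

lemma y_hom_transport:
  assumes lam: "constant_on_boxes lam" and lam': "constant_on_boxes lam'"
    and f: "y_hom n (glue_rep n I J lam) (glue_rep n I J lam') f"
    and z: "z \<in> {1..n}" "d z = 0" and i: "i \<in> {1..n}"
  shows "embed lam' i (f i v) = f z (embed lam i v)"
proof -
  have "\<forall>v. embed lam' i (f i v) = f z (embed lam i v)" (is "?P i")
  proof (rule vertex_induct[of z n ?P, OF z(1) _ i])
    have "embed mu z w = w" if "constant_on_boxes mu" for mu w
      using that z by (auto simp: constant_on_boxes_def embed_def Let_def)
    then show "?P z" using lam lam' by simp
    fix i assume i: "i \<in> {1..n}" and h: "?P (vert n (int i - 1))"
    show "?P i"
    proof
      fix v
      let ?h = "vert n (int i - 1)"
      have "weight I i \<odot>\<^bsub>plane\<^esub> embed lam' i (f i v) = embed lam' ?h (ymap (glue_rep n I J lam') i (f i v))"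
        using embed_ymap[OF lam' i] by simp
      also have "\<dots> = embed lam' ?h (f ?h (ymap (glue_rep n I J lam) i v))"
        using f i by (simp add: y_hom_def del: split_paired_All)
      also have "\<dots> = f z (weight I i \<odot>\<^bsub>plane\<^esub> embed lam i v)"
        using h embed_ymap[OF lam i] by (simp del: split_paired_All)
      also have "\<dots> = weight I i \<odot>\<^bsub>plane\<^esub> f z (embed lam i v)"
        using f z(1) by (auto simp: y_hom_def mod_hom_plane_iff)
      finally show "embed lam' i (f i v) = f z (embed lam i v)" by (simp add: prod_eq_iff)
    qed
  qed
  then show ?thesis ..
qed

(* At a vertex with positive gap, the embedded lattice reduces modulo t to the line through
   (lam i, 1), and f z has to map the lines of lam to those of lam'. *)
lemma y_hom_line:
  assumes "constant_on_boxes lam" "constant_on_boxes lam'"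
    and f: "y_hom n (glue_rep n I J lam) (glue_rep n I J lam') f"
    and z: "z \<in> {1..n}" "d z = 0" and i: "i \<in> {1..n}" "0 < d i"
  shows "lam i * (fst (f z (1, 0)) $ 0) + (fst (f z (0, 1)) $ 0) =
    lam' i * (lam i * (snd (f z (1, 0)) $ 0) + (snd (f z (0, 1)) $ 0))"
proof -
  have "f z \<in> mod_hom plane plane"
    using f z by (auto simp: y_hom_def)
  note matrix = mod_hom_plane_matrix[OF this]
  have "embed lam' i (f i (0, 1)) = f z (fps_const (lam i), 1)"
    using y_hom_transport[OF assms(1-3) z i(1), of "(0, 1)"] by (simp add: embed_def)
  then have eq: "embed lam' i (f i (0, 1)) =
      (fps_const (lam i) * fst (f z (1, 0)) + fst (f z (0, 1)),
       fps_const (lam i) * snd (f z (1, 0)) + snd (f z (0, 1)))"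
    using matrix[of "fps_const (lam i)" 1] by simp
  \<comment> \<open>The positive gap kills the term t^(d i) e modulo t, so only multiples of (lam'
    i, 1) remain.\<close>
  have "(fst (embed lam' i w)) $ 0 = lam' i * (snd (embed lam' i w) $ 0)" for w
    using i(2) by (simp add: embed_def)
  from this[of "f i (0, 1)"] show ?thesis
    unfolding eq by simp
qed

end

text \<open>If f vanishes modulo t, then 1 - f has a determinant with constant term 1. Multiplying
  (1 - f) v = 0 by the adjugate matrix shows that this determinant annihilates v.\<close>

lemma fixed_vector_zero_mod_t:
  assumes f: "f \<in> mod_hom plane plane"
    and zero: "fst (f (1, 0)) $ 0 = 0" "snd (f (1, 0)) $ 0 = 0" "fst (f (0, 1)) $ 0 = 0" "snd (f (0, 1)) $ 0 = 0"
    and fix_v: "f v = v"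
  shows "v = 0"
proof -
  obtain p q where v: "v = (p, q)" by (cases v)
  obtain a c where e: "f (1, 0) = (a, c)" by (cases "f (1, 0)")
  obtain b d where e': "f (0, 1) = (b, d)" by (cases "f (0, 1)")
  have pq: "p * a + q * b = p" "p * c + q * d = q"
    using fix_v mod_hom_plane_matrix[OF f, of p q] by (simp_all add: v e e')
  \<comment> \<open>The determinant of 1 - f.\<close>
  define u where "u = (1 - a) * (1 - d) - b * c"
  have "u $ 0 = 1" using zero by (simp add: u_def e e')
  then have "u \<noteq> 0" by auto
  have eqs: "p * (1 - a) = q * b" "p * c = q * (1 - d)"
    using pq by (metis add_diff_cancel_left' mult.right_neutral right_diff_distrib)
      (metis pq(2) add_diff_cancel_right' mult.right_neutral right_diff_distrib)
  have "p * u = p * (1 - a) * (1 - d) - p * c * b" by (simp add: u_def algebra_simps)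
  also have "\<dots> = 0" unfolding eqs by (simp add: mult_ac)
  finally have "p * u = 0" .
  moreover have "q * u = q * (1 - d) * (1 - a) - q * b * c" by (simp add: u_def algebra_simps)
  then have "q * u = 0" unfolding eqs[symmetric] by (simp add: mult_ac)
  ultimately have "p * u = 0" "q * u = 0" .
  with \<open>u \<noteq> 0\<close> show ?thesis by (simp add: v zero_prod_def)
qed

context rim_pair
begin

text \<open>A linear map of a plane that preserves three distinct lines is scalar. Slope 0 kills one
  off-diagonal entry; slopes 1 and -1 then equate the difference of the diagonal entries to plus and
  minus the other one.\<close>

lemma y_hom_scalar:
  assumes lam: "constant_on_boxes lam" and lam': "constant_on_boxes lam'"
    and f: "y_hom n (glue_rep n I J lam) (glue_rep n I J lam') f"
    and z: "z \<in> {1..n}" "d z = 0"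
    and p: "p \<in> {1..n}" "0 < d p" "lam p = 0" "lam' p = 0"
    and p': "p' \<in> {1..n}" "0 < d p'" "lam p' = 1" "lam' p' = 1"
    and p'': "p'' \<in> {1..n}" "0 < d p''" "lam p'' = - 1" "lam' p'' = - 1"
  shows "fst (f z (0, 1)) $ 0 = 0" "snd (f z (1, 0)) $ 0 = 0" "snd (f z (0, 1)) $ 0 = fst (f z (1, 0)) $ 0"
proof -
  note line = y_hom_line[OF lam lam' f z]
  show b: "fst (f z (0, 1)) $ 0 = 0"
    using line[OF p(1,2)] p by simp
  have "fst (f z (1, 0)) $ 0 = snd (f z (1, 0)) $ 0 + snd (f z (0, 1)) $ 0"
    using line[OF p'(1,2)] p' b by simp
  moreover have "fst (f z (1, 0)) $ 0 = snd (f z (0, 1)) $ 0 - snd (f z (1, 0)) $ 0"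
    using arg_cong[OF line[OF p''(1,2)], of uminus] p'' b by simp
  ultimately show "snd (f z (1, 0)) $ 0 = 0" "snd (f z (0, 1)) $ 0 = fst (f z (1, 0)) $ 0"
    by simp_all
qed

text \<open>Modulo t the isomorphism at z is a scalar, nonzero by surjectivity. A nonzero scalar
  preserves every line, so the slope at any further vertex of positive gap is the same on both
  sides.\<close>

lemma qrep_iso_value_eq:
  assumes lam: "constant_on_boxes lam" and lam': "constant_on_boxes lam'"
    and iso: "qrep_iso n (glue_rep n I J lam) (glue_rep n I J lam')"
    and z: "z \<in> {1..n}" "d z = 0"
    and p: "p \<in> {1..n}" "0 < d p" "lam p = 0" "lam' p = 0"
    and p': "p' \<in> {1..n}" "0 < d p'" "lam p' = 1" "lam' p' = 1"
    and p'': "p'' \<in> {1..n}" "0 < d p''" "lam p'' = - 1" "lam' p'' = - 1"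
    and i: "i \<in> {1..n}" "0 < d i"
  shows "lam i = lam' i"
proof -
  obtain f where f: "y_hom n (glue_rep n I J lam) (glue_rep n I J lam') f"
    and "bij_betw (f z) (carrier (space (glue_rep n I J lam) z)) (carrier (space (glue_rep n I J lam') z))"
    using iso z(1) unfolding qrep_iso_def y_hom_def Let_def by blast
  \<comment> \<open>A preimage of (1, 0) is all that is needed of bijectivity: its first coordinate
    equation modulo t excludes the scalar 0.\<close>
  then obtain v where v: "f z v = (1, 0)"
    by (metis bij_betw_def UNIV_I imageE space_glue_rep plane_simps(1))
  have fz: "f z \<in> mod_hom plane plane" using f z by (auto simp: y_hom_def)
  note scalar = y_hom_scalar[OF lam lam' f z p p' p'']
  have "fst v * fst (f z (1, 0)) + snd v * fst (f z (0, 1)) = 1"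
    using v mod_hom_plane_matrix[OF fz, of "fst v" "snd v"] by simp
  then have "(fst v * fst (f z (1, 0)) + snd v * fst (f z (0, 1))) $ 0 = 1" by simp
  then have "fst (f z (1, 0)) $ 0 \<noteq> 0" using scalar by auto
  then show ?thesis
    using y_hom_line[OF lam lam' f z i] scalar by simp
qed

end

section \<open>Projections of a direct sum decomposition\<close>

lemma plane_set_add: "A <+>\<^bsub>plane\<^esub> B = {v + w |v w. v \<in> A \<and> w \<in> B}"
  unfolding set_add_def' plane_simps by blast

lemma plane_set_add_commute: "A <+>\<^bsub>plane\<^esub> B = B <+>\<^bsub>plane\<^esub> A"
  unfolding plane_set_add by (rule Collect_cong) (metis add.commute)

definition projection :: "('b :: ab_group_add) set \<Rightarrow> 'b set \<Rightarrow> 'b \<Rightarrow> 'b"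
  where "projection N N' v = (THE w. w \<in> N \<and> v - w \<in> N')"

context
  fixes N N' :: "(complex fps \<times> complex fps) set"
  assumes sub: "submodule N centre plane" "submodule N' centre plane"
    and disjoint: "N \<inter> N' = {0}" and total: "N <+>\<^bsub>plane\<^esub> N' = UNIV"
begin

lemma projection_eq:
  assumes "w \<in> N" "v - w \<in> N'"
  shows "projection N N' v = w"
  unfolding projection_def
proof (rule the_equality)
  fix u assume u: "u \<in> N \<and> v - u \<in> N'"
  have diff: "x - y \<in> A" if "submodule A centre plane" "x \<in> A" "y \<in> A" for A x y
  proof -
    have "(- 1 * fst y, - 1 * snd y) \<in> A" using that unfolding submodule_plane_iff by blast
    then have "- y \<in> A" by (simp add: uminus_prod_def)
    then have "x + - y \<in> A" using that(1,2) unfolding submodule_plane_iff by blast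
    then show ?thesis by simp
  qed
  have "u - w \<in> N" using diff sub u assms by blast
  moreover have "(v - w) - (v - u) \<in> N'" using diff sub u assms by blast
  ultimately have "u - w \<in> N \<inter> N'" by simp
  then show "u = w" using disjoint by simp
qed (use assms in auto)

lemma projection_in: "projection N N' v \<in> N" "v - projection N N' v \<in> N'"
proof -
  have "v \<in> N <+>\<^bsub>plane\<^esub> N'" using total by simp
  then obtain w w' where "w \<in> N" "w' \<in> N'" "v = w + w'"
    unfolding plane_set_add by blast
  then show "projection N N' v \<in> N" "v - projection N N' v \<in> N'"
    using projection_eq[of w v] by simp_all
qed

lemma projection_ident: "v \<in> N \<Longrightarrow> projection N N' v = v"
  using sub by (intro projection_eq) (auto simp: submodule_plane_iff)

lemma projection_mod_hom: "projection N N' \<in> mod_hom plane plane"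
proof -
  have add: "v + w \<in> A" and scale: "(a * fst v, a * snd v) \<in> A"
    if "submodule A centre plane" "v \<in> A" "w \<in> A" for A v w a
    using that unfolding submodule_plane_iff by blast+
  let ?f = "projection N N'"
  have "?f (v + w) = ?f v + ?f w" for v w
  proof (rule projection_eq)
    have "v + w - (?f v + ?f w) = (v - ?f v) + (w - ?f w)" by simp
    then show "v + w - (?f v + ?f w) \<in> N'"
      using add[OF sub(2) projection_in(2) projection_in(2)] by metis
  qed (rule add[OF sub(1) projection_in(1) projection_in(1)])
  moreover have "?f (a * fst v, a * snd v) = (a * fst (?f v), a * snd (?f v))" for a v
  proof (rule projection_eq)
    have "(a * fst v, a * snd v) - (a * fst (?f v), a * snd (?f v)) =
        (a * fst (v - ?f v), a * snd (v - ?f v))"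
      by (simp add: right_diff_distrib)
    then show "(a * fst v, a * snd v) - (a * fst (?f v), a * snd (?f v)) \<in> N'"
      using scale[OF sub(2) projection_in(2) projection_in(2)] by metis
  qed (rule scale[OF sub(1) projection_in(1) projection_in(1)])
  ultimately show ?thesis unfolding mod_hom_plane_iff by blast
qed

end

text \<open>Exchanging the summands replaces an idempotent by its complement, which later reduces
  the scalar 1 modulo t to the scalar 0.\<close>

lemma projection_swap:
  assumes "submodule N centre plane" "submodule N' centre plane"
    "N \<inter> N' = {0}" "N <+>\<^bsub>plane\<^esub> N' = UNIV"
  shows "projection N' N v = v - projection N N' v"
proof (rule projection_eq)
  show "N' <+>\<^bsub>plane\<^esub> N = UNIV"
    using assms(4) plane_set_add_commute by blast
qed (use assms projection_in[OF assms] in auto)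

section \<open>Indecomposability\<close>

context rim_pair
begin

text \<open>A decomposition yields an idempotent family whose matrix at z is scalar modulo t, the
  scalar being 0 or 1. After exchanging the summands it is 0; then the idempotent vanishes at z,
  hence at every vertex by transport.\<close>

lemma glue_rep_indecomposable:
  assumes lam: "constant_on_boxes lam"
    and z: "z \<in> {1..n}" "d z = 0"
    and p: "p \<in> {1..n}" "0 < d p" "lam p = 0"
    and p': "p' \<in> {1..n}" "0 < d p'" "lam p' = 1"
    and p'': "p'' \<in> {1..n}" "0 < d p''" "lam p'' = - 1"
  shows "indecomposable n (glue_rep n I J lam)"
proof -
  let ?M = "glue_rep n I J lam"
  define splits where "splits N N' \<longleftrightarrow> subrep n ?M N \<and> subrep n ?M N' \<and>
    (\<forall>i \<in> {1..n}. N i \<inter> N' i = {0} \<and> N i <+>\<^bsub>plane\<^esub> N' i = UNIV)" for N N'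
  have splitsD: "submodule (N i) centre plane" "submodule (N' i) centre plane"
    "N i \<inter> N' i = {0}" "N i <+>\<^bsub>plane\<^esub> N' i = UNIV" if "splits N N'" "i \<in> {1..n}" for N N' i
    using that by (auto simp: splits_def subrep_def Let_def)
  have hom: "y_hom n ?M ?M (\<lambda>i. projection (N i) (N' i))" if s: "splits N N'" for N N'
    unfolding y_hom_def
  proof (intro ballI conjI)
    fix i v assume i: "i \<in> {1..n}"
    let ?h = "vert n (int i - 1)"
    show "projection (N i) (N' i) \<in> mod_hom (space ?M i) (space ?M i)"
      using projection_mod_hom splitsD[OF s i] by simp
    let ?w = "projection (N i) (N' i) v"
    have w: "?w \<in> N i" "v - ?w \<in> N' i" using projection_in[OF splitsD[OF s i]] by auto
    have "ymap ?M i ?w \<in> N ?h" "ymap ?M i (v - ?w) \<in> N' ?h"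
      using s i w unfolding splits_def subrep_def Let_def by blast+
    moreover have "ymap ?M i (v - ?w) = ymap ?M i v - ymap ?M i ?w"
      by (simp add: glue_rep_def algebra_simps)
    ultimately show "projection (N ?h) (N' ?h) (ymap ?M i v) = ymap ?M i ?w"
      using projection_eq[OF splitsD[OF s vert_pred[OF i]]] by simp
  qed
  have zero: "zero_family n ?M N"
    if s: "splits N N'" and c: "fst (projection (N z) (N' z) (1, 0)) $ 0 = 0" for N N'
    unfolding zero_family_def
  proof
    fix i assume i: "i \<in> {1..n}"
    note Z = splitsD[OF s z(1)]
    note scalar = y_hom_scalar[OF lam lam hom[OF s] z p p(3) p' p'(3) p'' p''(3)]
    \<comment> \<open>Every value of the projection is fixed by it, while its matrix vanishes modulo
      t.\<close>
    have "projection (N z) (N' z) v = 0" for v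
      by (rule fixed_vector_zero_mod_t[OF projection_mod_hom[OF Z]])
        (use scalar c projection_ident[OF Z] projection_in[OF Z] in auto)
    moreover have "embed lam i 0 = 0"
      by (simp add: embed_def zero_prod_def)
    ultimately have "embed lam i (projection (N i) (N' i) v) = embed lam i 0" for v
      using y_hom_transport[OF lam lam hom[OF s] z i, of v] by simp
    then have "projection (N i) (N' i) v = 0" for v
      using inj_embed by (metis injD)
    then have "v = 0" if "v \<in> N i" for v
      using projection_ident[OF splitsD[OF s i] that] by simp
    then show "N i = {\<zero>\<^bsub>space ?M i\<^esub>}"
      using splitsD(1)[OF s i] by (auto simp: submodule_plane_iff)
  qed
  have "zero_family n ?M N \<or> zero_family n ?M N'" if s: "splits N N'" for N N'
  proof -
    note Z = splitsD[OF s z(1)]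
    let ?f = "projection (N z) (N' z)"
    note scalar = y_hom_scalar[OF lam lam hom[OF s] z p p(3) p' p'(3) p'' p''(3)]
    have idem: "?f (?f (1, 0)) = ?f (1, 0)"
      using projection_ident[OF Z] projection_in[OF Z] by blast
    have "fst (?f w) = fst w * fst (?f (1, 0)) + snd w * fst (?f (0, 1))" for w
      using mod_hom_plane_matrix[OF projection_mod_hom[OF Z], of "fst w" "snd w"] by simp
    \<comment> \<open>The off-diagonal constant terms vanish, so idempotency modulo t reads a = a *
      a for the constant term a of the first diagonal entry.\<close>
    from arg_cong[OF this[of "?f (1, 0)"], of "\<lambda>u. u $ 0"]
    have "fst (?f (1, 0)) $ 0 = fst (?f (1, 0)) $ 0 * fst (?f (1, 0)) $ 0"
      using scalar unfolding idem by simp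
    then have "fst (?f (1, 0)) $ 0 = 0 \<or> fst (?f (1, 0)) $ 0 = 1"
      by simp
    moreover have "splits N' N"
      using s unfolding splits_def by (metis Int_commute plane_set_add_commute)
    ultimately show ?thesis
      using zero[OF s] zero[of N' N] projection_swap[OF Z, of "(1, 0)"] by auto
  qed
  moreover have "\<not> zero_family n ?M (\<lambda>i. carrier (space ?M i))"
  proof
    assume "zero_family n ?M (\<lambda>i. carrier (space ?M i))"
    then have "(1, 1) \<in> {0 :: complex fps \<times> complex fps}"
      using z by (auto simp: zero_family_def)
    then show False by (simp add: zero_prod_def)
  qed
  ultimately show ?thesis
    by (auto simp: indecomposable_def splits_def)
qed

end


section \<open>Boxes\<close>

lemma box_subset: "0 < n \<Longrightarrow> A \<in> boxes n d \<Longrightarrow> A \<subseteq> {1..n}"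
  using vert_in by (fastforce simp: boxes_def cyclic_interval_def simp del: atLeastAtMost_iff)

text \<open>By maximality: a neighbour of positive gap beyond an end of the interval could be added
  to it, so it already belongs to the box.\<close>

lemma box_closed:
  assumes A: "A \<in> boxes n d" and i: "i \<in> {1..n}" and pos: "0 < d i" "0 < d (vert n (int i - 1))"
  shows "i \<in> A \<longleftrightarrow> vert n (int i - 1) \<in> A"
proof -
  have n: "0 < n" using i by auto
  from A obtain a l where l: "0 < l" and A_eq: "A = (\<lambda>j. vert n (a + int j)) ` {..<l}"
    by (auto simp: boxes_def cyclic_interval_def)
  have maximal: "A' = A" if "cyclic_interval n A'" "\<forall>i\<in>A'. 0 < d i" "A \<subseteq> A'" for A'
    using A that by (auto simp: boxes_def)
  have A_pos: "\<forall>i\<in>A. 0 < d i" using A by (auto simp: boxes_def)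
  show ?thesis
  proof
    assume "i \<in> A"
    then obtain j where j: "j < l" "i = vert n (a + int j)" by (auto simp: A_eq)
    then have h: "vert n (int i - 1) = vert n (a - 1 + int j)"
      using n by (simp add: vert_vert_diff algebra_simps)
    show "vert n (int i - 1) \<in> A"
    \<comment> \<open>Only the first vertex of the interval needs maximality, applied to the
      interval started one step earlier; any other vertex has its predecessor in the
      interval.\<close>
    proof (cases j)
      case 0
      have "insert (vert n (int i - 1)) A = (\<lambda>j. vert n (a - 1 + int j)) ` {..<Suc l}"
        by (simp add: lessThan_Suc_eq_insert_0 image_image A_eq h 0)
      then have "cyclic_interval n (insert (vert n (int i - 1)) A)"
        unfolding cyclic_interval_def by blast
      from maximal[OF this] A_pos pos show ?thesis by auto
    next
      case (Suc j')
      then have "vert n (int i - 1) = vert n (a + int j')" using h by simp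
      then show ?thesis unfolding A_eq by (rule image_eqI) (use Suc j in auto)
    qed
  next
    assume "vert n (int i - 1) \<in> A"
    then obtain j where j: "j < l" "vert n (int i - 1) = vert n (a + int j)" by (auto simp: A_eq)
    have "i = vert n (int (vert n (int i - 1)) + 1)"
      using i n by (simp only: vert_vert_add) (simp add: vert_of_nat)
    also have "\<dots> = vert n (a + int j + 1)"
      unfolding j(2) by (rule vert_vert_add[OF n])
    finally have i_eq: "i = vert n (a + int (Suc j))"
      by (simp add: algebra_simps)
    show "i \<in> A"
    proof (cases "Suc j = l")
      case True
      have "insert i A = (\<lambda>j. vert n (a + int j)) ` {..<Suc l}"
        unfolding lessThan_Suc by (simp add: A_eq i_eq flip: True)
      then have "cyclic_interval n (insert i A)"
        unfolding cyclic_interval_def by blast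
      from maximal[OF this] A_pos pos show ?thesis by auto
    next
      case False
      then have "Suc j < l" using j by simp
      then show ?thesis unfolding A_eq i_eq by blast
    qed
  qed
qed

text \<open>By \<open>box_closed\<close> membership in B propagates along the interval A, so boxes
  that meet contain each other.\<close>

lemma boxes_disjoint:
  assumes n: "0 < n" and A: "A \<in> boxes n d" and B: "B \<in> boxes n d" and "A \<inter> B \<noteq> {}"
  shows "A = B"
proof -
  have "A \<subseteq> B" if A: "A \<in> boxes n d" and B: "B \<in> boxes n d" and meet: "A \<inter> B \<noteq> {}" for A B
  proof -
    from A obtain a l where A_eq: "A = (\<lambda>j. vert n (a + int j)) ` {..<l}"
      by (auto simp: boxes_def cyclic_interval_def)
    have A_pos: "0 < d (vert n (a + int j))" if "j < l" for j
      using A that by (auto simp: boxes_def A_eq)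
    have step: "vert n (a + int (Suc j)) \<in> B \<longleftrightarrow> vert n (a + int j) \<in> B" if "Suc j < l" for j
    proof -
      have "vert n (int (vert n (a + int (Suc j))) - 1) = vert n (a + int j)"
        using n by (simp add: vert_vert_diff)
      then show ?thesis
        using box_closed[OF B vert_in[OF n, of "a + int (Suc j)"]] A_pos[OF that] A_pos[of j] that by simp
    qed
    have "vert n (a + int j) \<in> B \<longleftrightarrow> vert n (a + int 0) \<in> B" if "j < l" for j
      using that by (induction j) (use step in auto)
    then show ?thesis using meet by (auto simp: A_eq)
  qed
  then show ?thesis using assms by blast
qed

section \<open>The infinite family\<close>

lemma four_elements:
  assumes "4 \<le> card S"
  obtains a b c e where "{a, b, c, e} \<subseteq> S" "distinct [a, b, c, e]"
proof -
  obtain T where "T \<subseteq> S" "card T = 4"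
    using assms obtain_subset_with_card_n by metis
  moreover from this obtain a b c e where "T = {a, b, c, e}" "distinct [a, b, c, e]"
    by (auto simp: numeral_eq_Suc card_Suc_eq)
  ultimately show thesis using that by blast
qed

theorem theorem1p3:
  fixes k n r r1 :: nat and I J :: "nat set" and M :: "'a qrep"
  assumes "1 \<le> k" and "2 * k \<le> n"
    and "I \<subseteq> {1..n}" and "card I = k"
    and "J \<subseteq> {1..n}" and "card J = k"
    and "interlacing r I J" and "has_poset n I J r1"
    and "r1 \<le> r" and "4 \<le> r1"
    and "CM_module k n M" and "has_rank n M 2"
    and "indecomposable n M" and "has_profile n M I J"
  shows "\<exists>S :: (complex fps \<times> complex fps) qrep set.
    infinite S \<and>
    (\<forall>N \<in> S. CM_module k n N \<and> has_rank n N 2 \<and> indecomposable n N \<and> has_profile n N I J) \<and>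
    (\<forall>N \<in> S. \<forall>N' \<in> S. N \<noteq> N' \<longrightarrow> \<not> qrep_iso n N N')"
proof -
  have n: "0 < n" using assms(1,2) by simp
  obtain d where gap: "rim_gap n I J d" and card: "4 \<le> card (boxes n d)"
    using assms by (auto simp: has_poset_def)
  have min: "Min (d ` {1..n}) = 0" using gap by (simp add: rim_gap_def)
  have nonneg: "0 \<le> d i" if "i \<in> {1..n}" for i
    using that min by (metis Min_le finite_atLeastAtMost finite_imageI imageI)
  have "Min (d ` {1..n}) \<in> d ` {1..n}"
    using n by (intro Min_in) auto
  \<comment> \<open>The minimum of the gap is attained; at such a vertex the lattice is the standard
    one and matrices can be compared.\<close>
  then obtain z where z: "z \<in> {1..n}" "d z = 0"
    using min by (metis imageE)
  interpret rim_pair n k I J "\<lambda>i. nat (d i)"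
  proof
    fix i assume i: "i \<in> {1..n}"
    have "d i - d (vert n (int i - 1)) = (if i \<in> J - I then 1 else if i \<in> I - J then - 1 else 0)"
      using gap i by (simp add: rim_gap_def)
    then show "nat (d i) + (if i \<in> I - J then 1 else 0) =
        nat (d (vert n (int i - 1))) + (if i \<in> J - I then 1 else 0)"
      using nonneg[OF i] nonneg[OF vert_pred[OF i]] by (auto split: if_splits)
  qed (use assms n in auto)
  obtain A\<^sub>0 A\<^sub>1 A\<^sub>2 A\<^sub>3
    where boxes: "{A\<^sub>0, A\<^sub>1, A\<^sub>2, A\<^sub>3} \<subseteq> boxes n d"
      and dist: "distinct [A\<^sub>0, A\<^sub>1, A\<^sub>2, A\<^sub>3]"
    using card four_elements by blast
  \<comment> \<open>Three boxes carry the rigidifying slopes, with 0 on \<open>A\<^sub>0\<close>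
    coming from the default branch; the box \<open>A\<^sub>3\<close> carries the free
    parameter.\<close>
  define lam :: "complex \<Rightarrow> nat \<Rightarrow> complex"
    where "lam mu i = (if i \<in> A\<^sub>1 then 1 else if i \<in> A\<^sub>2 then - 1 else if i \<in> A\<^sub>3 then mu else 0)" for mu i
  have box_pos: "0 < d i" if "i \<in> A" "A \<in> boxes n d" for i A
    using that by (auto simp: boxes_def)
  have lam: "constant_on_boxes (lam mu)" for mu
    unfolding constant_on_boxes_def Let_def
  proof (intro ballI conjI impI)
    fix i assume i: "i \<in> {1..n}"
    show "lam mu i = 0" if "nat (d i) = 0"
    proof -
      have "i \<notin> A" if "A \<in> boxes n d" for A
        using box_pos[OF _ that, of i] \<open>nat (d i) = 0\<close> by auto
      then show ?thesis using boxes by (simp add: lam_def)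
    qed
    show "lam mu i = lam mu (vert n (int i - 1))"
      if "0 < nat (d i) \<and> 0 < nat (d (vert n (int i - 1)))"
      using that box_closed[OF _ i, of _ d] boxes by (simp add: lam_def)
  qed
  have "\<exists>i. i \<in> A \<and> i \<in> {1..n} \<and> 0 < nat (d i)" if A: "A \<in> boxes n d" for A
  proof -
    have "A \<noteq> {}" using A by (auto simp: boxes_def cyclic_interval_def)
    then show ?thesis using box_subset[OF n A] box_pos[OF _ A] by fastforce
  qed
  then obtain p where p: "p A \<in> A" "p A \<in> {1..n}" "0 < nat (d (p A))" if "A \<in> boxes n d" for A
    by metis
  have p_in_iff: "p A \<in> B \<longleftrightarrow> A = B" if "A \<in> boxes n d" "B \<in> boxes n d" for A B
    using boxes_disjoint[OF n that] p[OF that(1)] by blast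
  have p_lam: "lam mu (p A\<^sub>0) = 0" "lam mu (p A\<^sub>1) = 1" "lam mu (p A\<^sub>2) = - 1" "lam mu (p A\<^sub>3) = mu" for mu
    using boxes dist by (auto simp: lam_def p_in_iff)
  let ?N = "\<lambda>mu. glue_rep n I J (lam mu)"
  have p0: "p A\<^sub>0 \<in> {1..n}" "0 < nat (d (p A\<^sub>0))" and p1: "p A\<^sub>1 \<in> {1..n}" "0 < nat (d (p A\<^sub>1))"
    and p2: "p A\<^sub>2 \<in> {1..n}" "0 < nat (d (p A\<^sub>2))" and p3: "p A\<^sub>3 \<in> {1..n}" "0 < nat (d (p A\<^sub>3))"
    using boxes p by auto
  have z': "nat (d z) = 0" using z by simp
  \<comment> \<open>The slope on the fourth box is the parameter itself, so the parameter is an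
    isomorphism invariant.\<close>
  have iso: "mu = mu'" if "qrep_iso n (?N mu) (?N mu')" for mu mu'
    using qrep_iso_value_eq[OF lam lam that z(1) z' p0 p_lam(1,1) p1 p_lam(2,2) p2 p_lam(3,3) p3]
    by (simp add: p_lam)
  \<comment> \<open>Equal representations are isomorphic by reflexivity, so the invariant also shows
    that distinct parameters give distinct representations.\<close>
  have "inj ?N"
  proof (rule injI)
    fix mu mu' assume "?N mu = ?N mu'"
    then show "mu = mu'" using iso[of mu mu'] qrep_iso_refl[of n "?N mu"] by simp
  qed
  then have "infinite (range ?N)"
    using infinite_UNIV_char_0 by (simp add: finite_image_iff)
  moreover have "indecomposable n (?N mu)" for mu
    by (rule glue_rep_indecomposable[OF lam z(1) z' p0 p_lam(1) p1 p_lam(2) p2 p_lam(3)])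
  moreover have "\<not> qrep_iso n N N'" if "N \<in> range ?N" "N' \<in> range ?N" "N \<noteq> N'" for N N'
  proof
    obtain mu mu' where N: "N = ?N mu" "N' = ?N mu'" using \<open>N \<in> range ?N\<close> \<open>N' \<in> range ?N\<close> by blast
    assume "qrep_iso n N N'"
    then show False using iso[of mu mu'] \<open>N \<noteq> N'\<close> by (simp add: N)
  qed
  ultimately show ?thesis
    using CM_module_glue_rep[OF lam] has_rank_glue_rep glue_rep_profile[OF n]
    by (intro exI[of _ "range ?N"] conjI ballI impI) (simp_all, auto)
qed

end
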